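(* Let $G=(V\cup E,\varepsilon)$ be a connected bipartite graph with a 2-vertex cut $\{e_1,e_2\}\subset E$. Then the degree of the interior polynomial $I_G(x)$ is at most $\min\{|E|-1,\ |V|-t+1\}$, where $t$ is the number of connected components of $G-\{e_1,e_2\}$.
   Context: $G=(V\cup E,\varepsilon)$ denotes a finite simple bipartite graph with non-empty colour classes $V$ and $E$ and edge set $\varepsilon$; the elements of $E$ are called hyperedges. A 2-vertex cut is a set of two distinct vertices whose deletion (with all incident edges) leaves a disconnected graph. For connected $G$, a hypertree of $G$ is a function $f:E\to\{0,1,2,\dots\}$ for which there is a spanning tree $\tau$ of $G$ with $d_\tau(e)=f(e)+1$ for every $e\in E$. For distinct $e,e'\in E$, we say that $e$ can transfer valence to $e'$ with respect to a hypertree $f$ if the function obtained from $f$ by decreasing $f(e)$ by 1 and increasing $f(e')$ by 1 is also a hypertree. Fix a total order on $E$. A hyperedge $e$ is internally inactive with respect to $f$ if there is $e'<e$ such that $e$ can transfer valence to $e'$ with respect to $f$; otherwise it is internally active. Let $\overline{\iota}(f)$ be the number of internally inactive hyperedges. The interior polynomial is $I_G(x)=\sum_f x^{\overline{\iota}(f)}$, the sum being over all hypertrees $f$ of $G$. It is known that $I_G$ does not depend on the order on $E$, nor on which of the two colour classes is taken as the set of hyperedges. *)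

theory Defs
  imports "HOL-Computational_Algebra.Polynomial" "HOL-Library.FuncSet"
begin

text \<open>
  A finite simple graph is given by a vertex set \<open>W\<close> and a set \<open>F\<close> of two-element subsets
  of \<open>W\<close>. The spanning trees of the AFP entry on digraphs are not suitable here: they forbid
  only directed cycles.
\<close>

definition graph_reachable :: "'a set \<Rightarrow> 'a set set \<Rightarrow> 'a rel" where
  "graph_reachable W F =
     {(u, v) \<in> W \<times> W. (u, v) \<in> {(x, y). x \<in> W \<and> y \<in> W \<and> {x, y} \<in> F}\<^sup>*}"

text \<open>The empty graph counts as connected; it plays no role below.\<close>

definition graph_connected :: "'a set \<Rightarrow> 'a set set \<Rightarrow> bool" where
  "graph_connected W F \<longleftrightarrow> (\<forall>u\<in>W. \<forall>v\<in>W. (u, v) \<in> graph_reachable W F)"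

definition graph_components :: "'a set \<Rightarrow> 'a set set \<Rightarrow> 'a set set" where
  "graph_components W F = W // graph_reachable W F"

definition graph_cycle :: "'a set set \<Rightarrow> 'a list \<Rightarrow> bool" where
  "graph_cycle F xs \<longleftrightarrow> length xs \<ge> 3 \<and> distinct xs \<and>
     (\<forall>i. Suc i < length xs \<longrightarrow> {xs ! i, xs ! Suc i} \<in> F) \<and> {last xs, hd xs} \<in> F"

definition graph_tree :: "'a set \<Rightarrow> 'a set set \<Rightarrow> bool" where
  "graph_tree W F \<longleftrightarrow> graph_connected W F \<and> (\<nexists>xs. graph_cycle F xs)"

definition graph_spanning_tree :: "'a set \<Rightarrow> 'a set set \<Rightarrow> 'a set set \<Rightarrow> bool" where
  "graph_spanning_tree W F \<tau> \<longleftrightarrow> \<tau> \<subseteq> F \<and> graph_tree W \<tau>"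

definition vertex_degree :: "'a set set \<Rightarrow> 'a \<Rightarrow> nat" where
  "vertex_degree F x = card {d \<in> F. x \<in> d}"

definition delete_edges_at :: "'a set set \<Rightarrow> 'a set \<Rightarrow> 'a set set" where
  "delete_edges_at F S = {d \<in> F. d \<inter> S = {}}"

definition two_vertex_cut :: "'a set \<Rightarrow> 'a set set \<Rightarrow> 'a set \<Rightarrow> bool" where
  "two_vertex_cut W F S \<longleftrightarrow>
     S \<subseteq> W \<and> card S = 2 \<and> \<not> graph_connected (W - S) (delete_edges_at F S)"

definition bipartite_graph :: "'a set \<Rightarrow> 'a set \<Rightarrow> 'a set set \<Rightarrow> bool" where
  "bipartite_graph V E \<epsilon> \<longleftrightarrow>
     finite V \<and> finite E \<and> V \<noteq> {} \<and> E \<noteq> {} \<and> V \<inter> E = {} \<and>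
     \<epsilon> \<subseteq> {{v, e} | v e. v \<in> V \<and> e \<in> E}"

text \<open>
  A function on \<open>E\<close> is encoded as an extensional total function, so that distinct
  hypertrees differ on \<open>E\<close> and there are only finitely many of them.
\<close>

definition hypertree :: "'a set \<Rightarrow> 'a set \<Rightarrow> 'a set set \<Rightarrow> ('a \<Rightarrow> nat) \<Rightarrow> bool" where
  "hypertree V E \<epsilon> f \<longleftrightarrow> f \<in> E \<rightarrow>\<^sub>E UNIV \<and>
     (\<exists>\<tau>. graph_spanning_tree (V \<union> E) \<epsilon> \<tau> \<and> (\<forall>e\<in>E. vertex_degree \<tau> e = f e + 1))"

text \<open>
  The condition \<open>f e > 0\<close> is needed because subtraction on \<^typ>\<open>nat\<close> truncates: a function
  with a negative value is never a hypertree.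
\<close>

definition can_transfer_valence ::
  "'a set \<Rightarrow> 'a set \<Rightarrow> 'a set set \<Rightarrow> ('a \<Rightarrow> nat) \<Rightarrow> 'a \<Rightarrow> 'a \<Rightarrow> bool" where
  "can_transfer_valence V E \<epsilon> f e e' \<longleftrightarrow> e \<in> E \<and> e' \<in> E \<and> e \<noteq> e' \<and> f e > 0 \<and>
     hypertree V E \<epsilon> (f(e := f e - 1, e' := f e' + 1))"

text \<open>Here \<open>r\<close> is a reflexive total order on \<open>E\<close>, and \<open>e' < e\<close> means \<open>(e', e) \<in> r\<close> with \<open>e' \<noteq> e\<close>.\<close>

definition internally_inactive ::
  "'a set \<Rightarrow> 'a set \<Rightarrow> 'a set set \<Rightarrow> 'a rel \<Rightarrow> ('a \<Rightarrow> nat) \<Rightarrow> 'a \<Rightarrow> bool" where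
  "internally_inactive V E \<epsilon> r f e \<longleftrightarrow>
     (\<exists>e'\<in>E. (e', e) \<in> r \<and> e' \<noteq> e \<and> can_transfer_valence V E \<epsilon> f e e')"

definition internal_inactivity ::
  "'a set \<Rightarrow> 'a set \<Rightarrow> 'a set set \<Rightarrow> 'a rel \<Rightarrow> ('a \<Rightarrow> nat) \<Rightarrow> nat" where
  "internal_inactivity V E \<epsilon> r f = card {e \<in> E. internally_inactive V E \<epsilon> r f e}"

definition interior_polynomial ::
  "'a set \<Rightarrow> 'a set \<Rightarrow> 'a set set \<Rightarrow> 'a rel \<Rightarrow> int poly" where
  "interior_polynomial V E \<epsilon> r =
     (\<Sum>f | hypertree V E \<epsilon> f. monom 1 (internal_inactivity V E \<epsilon> r f))"

lemma finite_hypertrees: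
  assumes "bipartite_graph V E \<epsilon>"
  shows "finite {f. hypertree V E \<epsilon> f}"
proof (rule finite_subset)
  have fin: "finite V" "finite E" and "\<epsilon> \<subseteq> Pow (V \<union> E)"
    using assms by (auto simp: bipartite_graph_def)
  then have fe: "finite \<epsilon>"
    by (meson finite_Pow_iff finite_UnI finite_subset)
  show "{f. hypertree V E \<epsilon> f} \<subseteq> E \<rightarrow>\<^sub>E {..card \<epsilon>}"
  proof
    fix f assume "f \<in> {f. hypertree V E \<epsilon> f}"
    then obtain \<tau> where f: "f \<in> E \<rightarrow>\<^sub>E UNIV" and "\<tau> \<subseteq> \<epsilon>"
      and deg: "\<And>e. e \<in> E \<Longrightarrow> vertex_degree \<tau> e = f e + 1"
      by (auto simp: hypertree_def graph_spanning_tree_def)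
    then have "vertex_degree \<tau> e \<le> card \<epsilon>" for e
      unfolding vertex_degree_def by (intro card_mono[OF fe]) auto
    with deg have "f e \<le> card \<epsilon>" if "e \<in> E" for e
      using that by (metis add_leD1)
    with f show "f \<in> E \<rightarrow>\<^sub>E {..card \<epsilon>}"
      by (auto simp: PiE_iff)
  qed
  show "finite (E \<rightarrow>\<^sub>E {..card \<epsilon>})"
    using fin by (simp add: finite_PiE)
qed

end

theory Submission
  imports Defs
begin

text \<open>
  Delete a set \<open>S\<close> of hyperedges, leaving \<open>t\<close> components. A spanning tree restricts to a forest on
  the remaining vertices with at least \<open>t\<close> components, and counting its edges shows that every
  hypertree has total value at most \<open>|V| - t\<close> outside \<open>S\<close>. An inactive hyperedge has positive
  value, so at most \<open>|V| - t\<close> of them lie outside \<open>S\<close>. If all of \<open>S\<close> is inactive, then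
  the least element of \<open>S\<close> can transfer valence to a hyperedge outside \<open>S\<close>; the resulting
  hypertree obeys the same bound, so the bound for the original one improves by one. In both
  cases at most \<open>|V| - t + |S| - 1\<close> hyperedges are inactive. The two bounds of the theorem are the
  cases \<open>S = E\<close> (where \<open>t = |V|\<close>) and \<open>S = {e\<^sub>1, e\<^sub>2}\<close>.
\<close>

section \<open>Reachability classes and the effect of adding edges\<close>

lemma equiv_graph_reachable: "equiv W (graph_reachable W F)"
proof -
  let ?A = "{(x, y). x \<in> W \<and> y \<in> W \<and> {x, y} \<in> F}"
  have "sym ?A"
    by (auto simp: sym_def insert_commute)
  then have "sym (?A\<^sup>*)"
    by (rule sym_rtrancl)
  then show ?thesis
    unfolding graph_reachable_def
    by (intro equivI) (auto simp: refl_on_def sym_def trans_def intro: rtrancl_trans)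
qed

lemma graph_reachable_mono: "F \<subseteq> F' \<Longrightarrow> graph_reachable W F \<subseteq> graph_reachable W F'"
proof -
  assume "F \<subseteq> F'"
  then have "{(x, y). x \<in> W \<and> y \<in> W \<and> {x, y} \<in> F}\<^sup>* \<subseteq> {(x, y). x \<in> W \<and> y \<in> W \<and> {x, y} \<in> F'}\<^sup>*"
    by (intro rtrancl_mono) auto
  then show ?thesis
    unfolding graph_reachable_def by auto
qed

lemma graph_reachable_edge:
  "a \<in> W \<Longrightarrow> b \<in> W \<Longrightarrow> {a, b} \<in> F \<Longrightarrow> (a, b) \<in> graph_reachable W F"
  unfolding graph_reachable_def by auto

lemma finite_graph_components: "finite W \<Longrightarrow> finite (graph_components W F)"
  unfolding graph_components_def graph_reachable_def
  by (rule finite_quotient) auto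

lemma graph_components_no_edges: "graph_components W {} = (\<lambda>x. {x}) ` W"
proof -
  have "graph_reachable W {} = Id_on W"
    by (auto simp: graph_reachable_def)
  then show ?thesis
    by (auto simp: graph_components_def quotient_def)
qed

lemma card_graph_components_no_edges: "card (graph_components W {}) = card W"
  unfolding graph_components_no_edges by (simp add: card_image)

lemma graph_reachable_Image_class:
  assumes "F \<subseteq> F'" "x \<in> W"
  shows "graph_reachable W F' `` (graph_reachable W F `` {x}) = graph_reachable W F' `` {x}"
proof -
  have class_eq: "graph_reachable W F' `` {y} = graph_reachable W F' `` {x}"
    if "y \<in> graph_reachable W F `` {x}" for y
    using that graph_reachable_mono[OF assms(1), of W]
    by (intro equiv_class_eq[OF equiv_graph_reachable, symmetric]) auto
  have "x \<in> graph_reachable W F `` {x}"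
    by (rule equiv_class_self[OF equiv_graph_reachable assms(2)])
  then have "graph_reachable W F' `` (graph_reachable W F `` {x})
               = (\<Union>y\<in>graph_reachable W F `` {x}. graph_reachable W F' `` {x})"
    by (subst Image_eq_UN) (rule SUP_cong[OF refl class_eq])
  then show ?thesis
    using \<open>x \<in> graph_reachable W F `` {x}\<close> by auto
qed

text \<open>Adding edges only merges components: the class of \<open>F'\<close> containing a class
  of \<open>F\<close> is its image under the larger relation. This surjection turns statements about
  numbers of components into statements about maps.\<close>

lemma graph_components_image:
  assumes "F \<subseteq> F'"
  shows "graph_components W F' = (\<lambda>A. graph_reachable W F' `` A) ` graph_components W F"
proof -
  have comps: "graph_components W H = (\<lambda>x. graph_reachable W H `` {x}) ` W" for H
    by (auto simp: graph_components_def quotient_def)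
  show ?thesis
    unfolding comps image_image
    using graph_reachable_Image_class[OF assms] by (intro image_cong) auto
qed

lemma card_graph_components_antimono:
  "finite W \<Longrightarrow> F \<subseteq> F' \<Longrightarrow> card (graph_components W F') \<le> card (graph_components W F)"
  by (subst graph_components_image) (auto intro: card_image_le finite_graph_components)

text \<open>The surjection from old to new components identifies the distinct classes of
  \<open>a\<close> and \<open>b\<close>, so it is not injective and the count drops
  strictly.\<close>

lemma card_graph_components_insert:
  assumes fin: "finite W" and ab: "a \<in> W" "b \<in> W" and not: "(a, b) \<notin> graph_reachable W F"
  shows "card (graph_components W (insert {a, b} F)) < card (graph_components W F)"
proof -
  let ?R = "graph_reachable W F" and ?R' = "graph_reachable W (insert {a, b} F)"
  let ?h = "\<lambda>A. ?R' `` A"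
  have comps: "?R `` {a} \<in> graph_components W F" "?R `` {b} \<in> graph_components W F"
    using ab by (auto simp: graph_components_def quotient_def)
  have ne: "?R `` {a} \<noteq> ?R `` {b}"
    using not ab eq_equiv_class_iff[OF equiv_graph_reachable] by metis
  have h: "?h (?R `` {x}) = ?R' `` {x}" if "x \<in> W" for x
    using that by (intro graph_reachable_Image_class) auto
  have "?h (?R `` {a}) = ?h (?R `` {b})"
    using ab h equiv_class_eq[OF equiv_graph_reachable graph_reachable_edge[OF ab]] by simp
  then have "\<not> inj_on ?h (graph_components W F)"
    using comps ne by (meson inj_onD)
  then have "card (?h ` graph_components W F) < card (graph_components W F)"
    using finite_graph_components[OF fin]
    by (metis card_image_le eq_card_imp_inj_on le_neq_implies_less)
  then show ?thesis
    using graph_components_image[of F "insert {a, b} F" W] by (simp add: subset_insertI)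
qed

section \<open>Simple paths, cycles and forests\<close>

lemma graph_reachable_simple_path:
  assumes "(a, b) \<in> graph_reachable W F"
  shows "\<exists>xs. xs \<noteq> [] \<and> distinct xs \<and> hd xs = a \<and> last xs = b \<and>
           (\<forall>i. Suc i < length xs \<longrightarrow> {xs ! i, xs ! Suc i} \<in> F)"
proof -
  have "(a, b) \<in> {(x, y). x \<in> W \<and> y \<in> W \<and> {x, y} \<in> F}\<^sup>*"
    using assms by (simp add: graph_reachable_def)
  then show ?thesis
  proof (induction rule: rtrancl_induct)
    case base
    show ?case by (rule exI[of _ "[a]"]) simp
  next
    case (step y z)
    then obtain xs where xs: "xs \<noteq> []" "distinct xs" "hd xs = a" "last xs = y"
      and path: "\<And>i. Suc i < length xs \<Longrightarrow> {xs ! i, xs ! Suc i} \<in> F"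
      by blast
    show ?case
    proof (cases "z \<in> set xs")
      case True
      \<comment> \<open>The walk returns to a vertex of the path, so the path is cut off there; this
        keeps it simple.\<close>
      then obtain us vs where us: "xs = us @ z # vs"
        by (meson split_list)
      show ?thesis
      proof (rule exI[of _ "us @ [z]"], intro conjI allI impI)
        show "hd (us @ [z]) = a"
          using xs(3) us by (cases us) auto
        fix i assume "Suc i < length (us @ [z])"
        then show "{(us @ [z]) ! i, (us @ [z]) ! Suc i} \<in> F"
          using path[of i] us by (auto simp: nth_append less_Suc_eq split: if_splits)
      qed (use xs us in auto)
    next
      case False
      show ?thesis
      proof (rule exI[of _ "xs @ [z]"], intro conjI allI impI)
        fix i assume i: "Suc i < length (xs @ [z])"
        show "{(xs @ [z]) ! i, (xs @ [z]) ! Suc i} \<in> F"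
        proof (cases "Suc i < length xs")
          case True
          then show ?thesis using path[of i] by (simp add: nth_append)
        next
          case False
          then have "Suc i = length xs" using i by simp
          then have "xs ! i = y"
            using xs(1,4) by (metis last_conv_nth diff_Suc_1)
          then show ?thesis
            using step.hyps(2) \<open>Suc i = length xs\<close> by (auto simp: nth_append)
        qed
      qed (use xs False in auto)
    qed
  qed
qed

lemma graph_cycle_mono: "graph_cycle F xs \<Longrightarrow> F \<subseteq> F' \<Longrightarrow> graph_cycle F' xs"
  unfolding graph_cycle_def by (simp add: subset_iff)

text \<open>The new edge closes a simple path from \<open>a\<close> to \<open>b\<close>. That path
  has at least three vertices: one vertex would give \<open>a = b\<close>, two would put
  \<open>{a, b}\<close> into \<open>F\<close>.\<close>

lemma graph_cycle_insert_edge: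
  assumes "(a, b) \<in> graph_reachable W F" "a \<noteq> b" "{a, b} \<notin> F"
  shows "\<exists>xs. graph_cycle (insert {a, b} F) xs"
proof -
  obtain xs where xs: "xs \<noteq> []" "distinct xs" "hd xs = a" "last xs = b"
    and path: "\<forall>i. Suc i < length xs \<longrightarrow> {xs ! i, xs ! Suc i} \<in> F"
    using graph_reachable_simple_path[OF assms(1)] by blast
  have "length xs \<noteq> Suc 0"
    using xs assms(2) by (auto simp: length_Suc_conv)
  moreover have "length xs \<noteq> Suc (Suc 0)"
    using xs assms(3) path by (auto simp: length_Suc_conv)
  ultimately have "length xs \<ge> 3"
    using xs(1) by (cases xs rule: list.exhaust) (auto simp: Suc_le_eq numeral_3_eq_3 neq_Nil_conv)
  then have "graph_cycle (insert {a, b} F) xs"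
    using xs path by (simp add: graph_cycle_def insert_commute)
  then show ?thesis ..
qed

text \<open>Build the forest edge by edge. An edge within one component would close a cycle, so each
  edge joins two components and lowers their number.\<close>

lemma forest_card_le:
  assumes "finite W" "finite F" "\<nexists>xs. graph_cycle F xs"
    and "\<And>d. d \<in> F \<Longrightarrow> \<exists>a\<in>W. \<exists>b\<in>W. a \<noteq> b \<and> d = {a, b}"
  shows "card F + card (graph_components W F) \<le> card W"
  using assms(2-4)
proof (induction F rule: finite_induct)
  case empty
  then show ?case by (simp add: card_graph_components_no_edges)
next
  case (insert d F)
  then obtain a b where d: "a \<in> W" "b \<in> W" "a \<noteq> b" "d = {a, b}"
    by blast
  have "(a, b) \<notin> graph_reachable W F"
    using graph_cycle_insert_edge insert.hyps(2) insert.prems(1) d(3,4) by metis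
  then have "card (graph_components W (insert d F)) < card (graph_components W F)"
    using card_graph_components_insert[OF assms(1)] d by simp
  moreover have "card F + card (graph_components W F) \<le> card W"
    using insert.prems by (intro insert.IH) (auto dest: graph_cycle_mono)
  ultimately show ?case
    using insert.hyps by simp
qed

section \<open>The value of a hypertree outside a set of hyperedges\<close>

text \<open>The forest left from a spanning tree after deleting \<open>S\<close> has at least as
  many edges as the sum of \<open>f e + 1\<close> over \<open>E - S\<close>. In the forest bound the
  summands 1 cancel against the vertices in \<open>E - S\<close>, leaving only
  \<open>card V\<close>.\<close>

lemma hypertree_sum_outside:
  assumes G: "bipartite_graph V E \<epsilon>" and f: "hypertree V E \<epsilon> f" and S: "S \<subseteq> E"
  shows "sum f (E - S) + card (graph_components (V \<union> E - S) (delete_edges_at \<epsilon> S)) \<le> card V"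
proof -
  have fin: "finite V" "finite E" and dis: "V \<inter> E = {}"
    and edge: "\<And>d. d \<in> \<epsilon> \<Longrightarrow> \<exists>v\<in>V. \<exists>e\<in>E. d = {v, e}"
    using G unfolding bipartite_graph_def by blast+
  obtain \<tau> where \<tau>: "\<tau> \<subseteq> \<epsilon>" and acyc: "\<nexists>xs. graph_cycle \<tau> xs"
    and deg: "\<And>e. e \<in> E \<Longrightarrow> vertex_degree \<tau> e = f e + 1"
    using f unfolding hypertree_def graph_spanning_tree_def graph_tree_def by blast
  let ?F = "delete_edges_at \<tau> S" and ?W = "V \<union> E - S"
  have "\<epsilon> \<subseteq> Pow (V \<union> E)"
    using edge by blast
  then have fin\<tau>: "finite \<tau>"
    using \<tau> fin by (meson finite_Pow_iff finite_UnI finite_subset)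
  then have finF: "finite ?F"
    by (simp add: delete_edges_at_def)
  \<comment> \<open>An edge has only one end in \<open>E\<close>. Hence the stars of different
    hyperedges are disjoint, and the star of a hyperedge outside \<open>S\<close> survives the
    deletion.\<close>
  have unique: "e = e'" if d: "d \<in> \<epsilon>" "e \<in> E" "e' \<in> E" "e \<in> d" "e' \<in> d" for d e e'
  proof -
    obtain v e'' where "v \<in> V" "d = {v, e''}"
      using edge[OF d(1)] by blast
    then show ?thesis
      using d dis by auto
  qed
  have forest: "card ?F + card (graph_components ?W ?F) \<le> card ?W"
  proof (rule forest_card_le)
    show "\<nexists>xs. graph_cycle ?F xs"
      using acyc by (auto simp: delete_edges_at_def dest: graph_cycle_mono)
    fix d assume "d \<in> ?F"
    then show "\<exists>a\<in>?W. \<exists>b\<in>?W. a \<noteq> b \<and> d = {a, b}"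
    proof -
      have "d \<in> \<epsilon>" "d \<inter> S = {}"
        using \<open>d \<in> ?F\<close> \<tau> by (auto simp: delete_edges_at_def)
      then obtain v e where "v \<in> V" "e \<in> E" "d = {v, e}"
        using edge by metis
      then show ?thesis
        using \<open>d \<inter> S = {}\<close> dis by (intro bexI[of _ v] bexI[of _ e]) auto
    qed
  qed (use fin finF in auto)
  have comps: "card (graph_components ?W (delete_edges_at \<epsilon> S)) \<le> card (graph_components ?W ?F)"
    using fin \<tau> by (intro card_graph_components_antimono) (auto simp: delete_edges_at_def)
  have "(\<Sum>e\<in>E - S. f e + 1) = (\<Sum>e\<in>E - S. card {d \<in> \<tau>. e \<in> d})"
    using deg by (intro sum.cong) (auto simp: vertex_degree_def)
  also have "\<dots> = card (\<Union>e\<in>E - S. {d \<in> \<tau>. e \<in> d})"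
  proof (rule card_UN_disjoint[symmetric])
    show "\<forall>e\<in>E - S. \<forall>e'\<in>E - S. e \<noteq> e' \<longrightarrow> {d \<in> \<tau>. e \<in> d} \<inter> {d \<in> \<tau>. e' \<in> d} = {}"
      using unique \<tau> by blast
  qed (use fin fin\<tau> in auto)
  also have "\<dots> \<le> card ?F"
  proof (rule card_mono[OF finF], safe)
    fix e d assume "e \<in> E" "e \<notin> S" "d \<in> \<tau>" "e \<in> d"
    then have "d \<inter> S = {}"
      using unique[of d e] S \<tau> by blast
    then show "d \<in> ?F"
      using \<open>d \<in> \<tau>\<close> by (simp add: delete_edges_at_def)
  qed
  finally have "sum f (E - S) + card (E - S) \<le> card ?F"
    by (simp only: sum.distrib card_eq_sum)
  moreover have "card ?W = card V + card (E - S)"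
  proof -
    have "?W = V \<union> (E - S)"
      using dis S by auto
    then show ?thesis
      using fin dis by (simp add: card_Un_disjoint disjoint_iff)
  qed
  ultimately show ?thesis
    using forest comps by linarith
qed

section \<open>Counting internally inactive hyperedges\<close>

lemma linear_order_on_least:
  assumes "linear_order_on E r" "finite S" "S \<noteq> {}" "S \<subseteq> E"
  shows "\<exists>m\<in>S. \<forall>s\<in>S. (m, s) \<in> r"
  using assms(2-4)
proof (induction S rule: finite_ne_induct)
  case (singleton x)
  then show ?case
    using assms(1) by (auto simp: order_on_defs refl_on_def)
next
  case (insert x S)
  then obtain m where m: "m \<in> S" "\<forall>s\<in>S. (m, s) \<in> r"
    by auto
  have refl: "(x, x) \<in> r" and tot: "(m, x) \<in> r \<or> (x, m) \<in> r" and tr: "trans r"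
    using assms(1) insert.prems m(1) insert.hyps
    by (auto simp: order_on_defs refl_on_def total_on_def)
  then show ?case
    using m by (auto dest: transD[OF tr])
qed

text \<open>The strict inequality states the bound |V| - t + |S| - 1 without subtraction on
  naturals. The saved unit comes from the least element of \<open>S\<close>, whether it is active or
  inactive.\<close>

lemma internal_inactivity_le:
  assumes G: "bipartite_graph V E \<epsilon>" and r: "linear_order_on E r"
    and f: "hypertree V E \<epsilon> f" and S: "S \<subseteq> E" "S \<noteq> {}"
  shows "internal_inactivity V E \<epsilon> r f
           + card (graph_components (V \<union> E - S) (delete_edges_at \<epsilon> S)) < card V + card S"
proof -
  define I where "I = {e \<in> E. internally_inactive V E \<epsilon> r f e}"
  let ?t = "card (graph_components (V \<union> E - S) (delete_edges_at \<epsilon> S))"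
  have fin: "finite E" "finite S"
    using G S(1) by (auto simp: bipartite_graph_def intro: finite_subset)
  \<comment> \<open>Giving away valence requires a positive value, so the sum of \<open>f\<close>
    outside \<open>S\<close> dominates the number of inactive hyperedges there.\<close>
  have pos: "0 < f e" if "e \<in> I" for e
    using that by (auto simp: I_def internally_inactive_def can_transfer_valence_def)
  have "card (I - S) = (\<Sum>e\<in>I - S. 1)"
    by simp
  also have "\<dots> \<le> sum f (I - S)"
    using pos by (intro sum_mono) (auto simp: Suc_le_eq)
  also have "\<dots> \<le> sum f (E - S)"
    using fin by (intro sum_mono2) (auto simp: I_def)
  finally have out: "card (I - S) \<le> sum f (E - S)" .
  have finI: "finite I"
    using fin by (simp add: I_def)
  then have card_I: "card I = card (I - S) + card (I \<inter> S)"
    by (metis Int_commute card_Diff_subset_Int card_mono finite_Int inf_le1 le_add_diff_inverse2)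
  have sum_le: "sum f (E - S) + ?t \<le> card V"
    by (rule hypertree_sum_outside[OF G f S(1)])
  obtain m where m: "m \<in> S" "\<And>s. s \<in> S \<Longrightarrow> (m, s) \<in> r"
    using linear_order_on_least[OF r fin(2) S(2) S(1)] by blast
  have "card I + ?t < card V + card S"
  proof (cases "m \<in> I")
    case False
    then have "card (I \<inter> S) < card S"
      using m(1) fin by (intro psubset_card_mono) auto
    then show ?thesis
      using out card_I sum_le by linarith
  next
    case True
    then obtain e where e: "e \<in> E" "(e, m) \<in> r" "e \<noteq> m"
      and tr: "can_transfer_valence V E \<epsilon> f m e"
      by (auto simp: I_def internally_inactive_def)
    \<comment> \<open>\<open>m\<close> is least in \<open>S\<close>, so a strictly smaller hyperedge
      lies outside \<open>S\<close>.\<close>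
    have "e \<notin> S"
      using e m r by (auto simp: order_on_defs antisym_def)
    let ?g = "f(m := f m - 1, e := f e + 1)"
    have "hypertree V E \<epsilon> ?g"
      using tr by (simp add: can_transfer_valence_def)
    then have "sum ?g (E - S) + ?t \<le> card V"
      by (rule hypertree_sum_outside[OF G _ S(1)])
    \<comment> \<open>The transfer moves one unit from inside \<open>S\<close> to outside. As
      \<open>?g\<close> obeys the same bound, \<open>f\<close> stays at least one below it, which
      makes up for \<open>S\<close> being possibly all inactive.\<close>
    moreover have "sum ?g (E - S) = Suc (sum f (E - S))"
    proof -
      have "sum ?g (E - S) = ?g e + sum ?g (E - S - {e})"
        using fin e \<open>e \<notin> S\<close> by (intro sum.remove) auto
      also have "sum ?g (E - S - {e}) = sum f (E - S - {e})"
        using m(1) by (intro sum.cong) auto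
      also have "?g e + \<dots> = Suc (sum f (E - S))"
        using fin e \<open>e \<notin> S\<close> by (subst sum.remove[of "E - S" e]) auto
      finally show ?thesis .
    qed
    moreover have "card (I \<inter> S) \<le> card S"
      using fin by (intro card_mono) auto
    ultimately show ?thesis
      using out card_I by linarith
  qed
  then show ?thesis
    by (simp add: internal_inactivity_def I_def)
qed

text \<open>Every component meets \<open>V\<close>, since a hyperedge outside \<open>S\<close> keeps
  all its neighbours and has at least one by connectedness. This later guarantees that
  \<open>card V - t\<close> does not truncate.\<close>

lemma card_components_le_card_colour_class:
  assumes G: "bipartite_graph V E \<epsilon>" and conn: "graph_connected (V \<union> E) \<epsilon>" and S: "S \<subseteq> E"
  shows "card (graph_components (V \<union> E - S) (delete_edges_at \<epsilon> S)) \<le> card V"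
proof -
  let ?R = "graph_reachable (V \<union> E - S) (delete_edges_at \<epsilon> S)"
  have fin: "finite V" and ne: "V \<noteq> {}" and dis: "V \<inter> E = {}"
    and edge: "\<And>d. d \<in> \<epsilon> \<Longrightarrow> \<exists>v\<in>V. \<exists>e\<in>E. d = {v, e}"
    using G unfolding bipartite_graph_def by blast+
  have "\<exists>v\<in>V. ?R `` {x} = ?R `` {v}" if x: "x \<in> V \<union> E - S" for x
  proof (cases "x \<in> V")
    case False
    then have "x \<in> E"
      using x by auto
    obtain w where w: "w \<in> V"
      using ne by auto
    \<comment> \<open>A walk from \<open>x\<close> to a vertex of \<open>V\<close> is nontrivial
      because \<open>x\<close> is not in \<open>V\<close>; its first step supplies the neighbour
      \<open>y\<close>.\<close>
    have "(x, w) \<in> {(x, y). x \<in> V \<union> E \<and> y \<in> V \<union> E \<and> {x, y} \<in> \<epsilon>}\<^sup>*"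
      using conn w x by (auto simp: graph_connected_def graph_reachable_def)
    then obtain y where y: "{x, y} \<in> \<epsilon>"
      using w False by (auto elim: converse_rtranclE)
    then have "y \<in> V"
      using edge[OF y] \<open>x \<in> E\<close> dis by (auto simp: doubleton_eq_iff)
    then have "(x, y) \<in> ?R"
      using x y S dis by (intro graph_reachable_edge) (auto simp: delete_edges_at_def)
    then show ?thesis
      using \<open>y \<in> V\<close> equiv_class_eq[OF equiv_graph_reachable] by metis
  qed auto
  then have "graph_components (V \<union> E - S) (delete_edges_at \<epsilon> S) \<subseteq> (\<lambda>v. ?R `` {v}) ` V"
    by (force simp: graph_components_def quotient_def)
  then show ?thesis
    using fin by (rule surj_card_le[rotated])
qed

theorem theorem28:
  fixes V E :: "'a set" and \<epsilon> :: "'a set set" and r :: "'a rel" and e\<^sub>1 e\<^sub>2 :: 'a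
  assumes "bipartite_graph V E \<epsilon>"
    and "graph_connected (V \<union> E) \<epsilon>"
    and "linear_order_on E r"
    and "{e\<^sub>1, e\<^sub>2} \<subseteq> E"
    and "two_vertex_cut (V \<union> E) \<epsilon> {e\<^sub>1, e\<^sub>2}"
    and "t = card (graph_components (V \<union> E - {e\<^sub>1, e\<^sub>2}) (delete_edges_at \<epsilon> {e\<^sub>1, e\<^sub>2}))"
  shows "int (degree (interior_polynomial V E \<epsilon> r))
           \<le> min (int (card E) - 1) (int (card V) - int t + 1)"
proof -
  note G = assms(1) and r = assms(3)
  have dis: "V \<inter> E = {}" and ne: "E \<noteq> {}" and fin: "finite E"
    and edge: "\<And>d. d \<in> \<epsilon> \<Longrightarrow> \<exists>v\<in>V. \<exists>e\<in>E. d = {v, e}"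
    using G unfolding bipartite_graph_def by blast+
  have card2: "card {e\<^sub>1, e\<^sub>2} = 2"
    using assms(5) by (simp add: two_vertex_cut_def)
  have t: "t \<le> card V"
    using card_components_le_card_colour_class[OF G assms(2) assms(4)] assms(6) by simp
  \<comment> \<open>For \<open>S = E\<close> only isolated vertices remain, so the number of
    components is \<open>card V\<close> and the general bound becomes inactivity below
    \<open>card E\<close>.\<close>
  have E: "V \<union> E - E = V" "delete_edges_at \<epsilon> E = {}"
    using dis edge by (auto simp: delete_edges_at_def dest!: edge)
  have "internal_inactivity V E \<epsilon> r f \<le> min (card E - 1) (card V - t + 1)"
    if f: "hypertree V E \<epsilon> f" for f
  proof -
    have "internal_inactivity V E \<epsilon> r f < card E"
      using internal_inactivity_le[OF G r f order_refl ne] E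
      by (simp add: card_graph_components_no_edges)
    moreover have "internal_inactivity V E \<epsilon> r f + t < card V + 2"
      using internal_inactivity_le[OF G r f assms(4)] card2 assms(6) by simp
    ultimately show ?thesis
      using t by auto
  qed
  then have "degree (interior_polynomial V E \<epsilon> r) \<le> min (card E - 1) (card V - t + 1)"
    unfolding interior_polynomial_def
    by (intro degree_sum_le finite_hypertrees[OF G]) (auto intro: order_trans[OF degree_monom_le])
  \<comment> \<open>Together with \<open>t \<le> card V\<close>, this makes both natural-number
    subtractions agree with the integer ones in the claim.\<close>
  moreover have "card E > 0"
    using ne fin by (simp add: card_gt_0_iff)
  ultimately show ?thesis
    using t by linarith
qed

end
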